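(* Let $(Y,d)$ be a continuum which contains a dense subspace $X$ that is an indecomposable semicontinuum. Then there is a sequence of pairwise disjoint subcontinua $K_0,K_1,K_2,\ldots$ of $Y$ such that $\sup_{y\in Y}d(y,K_n)\to 0$ as $n\to\infty$.
   Context: All spaces are separable and metrizable. A continuum is a compact connected metrizable space with more than one point; a subcontinuum of $Y$ is a subspace of $Y$ that is a continuum; $d$ is a metric inducing the topology of $Y$. A semicontinuum is a continuum-wise connected space, i.e. a space $X$ such that every two points of $X$ lie in a continuum contained in $X$. An indecomposable semicontinuum is a semicontinuum which cannot be written as the union of two proper closed connected subsets (closed in $X$). For $y\in Y$ and non-empty $A\subset Y$, $d(y,A)=\inf_{a\in A}d(y,a)$. *)

theory Defs
  imports "HOL-Analysis.Analysis"
begin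

definition continuum :: "'a::metric_space set \<Rightarrow> bool" where
  "continuum K \<longleftrightarrow> compact K \<and> connected K \<and> (\<exists>x\<in>K. \<exists>y\<in>K. x \<noteq> y)"

(* "Every two points" is read as "every two distinct points".  For a set with more than one
   point, dropping x \<noteq> y would give the same notion. *)
definition semicontinuum :: "'a::metric_space set \<Rightarrow> bool" where
  "semicontinuum X \<longleftrightarrow>
     (\<forall>x\<in>X. \<forall>y\<in>X. x \<noteq> y \<longrightarrow> (\<exists>K. continuum K \<and> K \<subseteq> X \<and> x \<in> K \<and> y \<in> K))"

definition indecomposable_semicontinuum :: "'a::metric_space set \<Rightarrow> bool" where
  "indecomposable_semicontinuum X \<longleftrightarrow>
     semicontinuum X \<and>
     \<not> (\<exists>A B. closedin (top_of_set X) A \<and> connected A \<and> A \<noteq> X \<and>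
              closedin (top_of_set X) B \<and> connected B \<and> B \<noteq> X \<and>
              X = A \<union> B)"

end

theory Submission
  imports Defs
begin

text \<open>
  The continua are found inside \<open>X\<close>, one after another. Given finitely many proper compact
  connected subsets of \<open>X\<close>, with union \<open>F\<close>, and finitely many open sets \<open>W\<close> meeting \<open>X\<close>, there is a
  continuum in \<open>X - F\<close> that meets every \<open>W\<close> (lemma \<open>continuum_avoiding_finite_family\<close>). Letting the
  open sets be the balls of a finite \<open>\<epsilon>\<close>-net of \<open>Y\<close> with centres in \<open>X\<close>, and \<open>F\<close> the union of the
  continua already chosen, yields the sequence.

  The lemma rests on the constituents of \<open>X - F\<close>: two points lie in the same constituent if a
  compact connected subset of \<open>X - F\<close> contains both. Since \<open>X\<close> is a semicontinuum, boundary bumping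
  shows that the closure of each constituent meets \<open>F\<close>
  (lemma \<open>constituent_clusters_at_removed_set\<close>). If no continuum in \<open>X - F\<close> meets every \<open>W\<close>, then each
  constituent misses some \<open>W\<close>, so \<open>X - F\<close> is covered by finitely many sets \<open>A(W,K)\<close>: the closure of
  the union of \<open>K\<close> with all constituents that miss \<open>W\<close> and cluster at the member \<open>K\<close> of the given
  family. Each \<open>A(W,K)\<close> is connected because everything is attached to \<open>K\<close>, and proper because it
  misses \<open>W - F\<close>. But in an indecomposable space proper closed connected sets are nowhere dense
  (lemma \<open>indecomposable_closed_connected_interior_empty\<close>), and finitely many of them cannot cover
  the space.

  The chosen continua are not first joined into one continuum: for compact \<open>X\<close> such a continuum may
  be all of \<open>X\<close>. This is why the lemma avoids a family whose union may be disconnected, and why the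
  sets \<open>A(W,K)\<close> depend on \<open>K\<close>.
\<close>

section \<open>Constituents\<close>

definition constituent :: "'a::topological_space set \<Rightarrow> 'a \<Rightarrow> 'a set" where
  "constituent S x = \<Union>{M. compact M \<and> connected M \<and> M \<subseteq> S \<and> x \<in> M}"

lemma constituent_subset: "constituent S x \<subseteq> S"
  by (auto simp: constituent_def)

lemma in_constituent: "x \<in> S \<Longrightarrow> x \<in> constituent S x"
  by (auto simp: constituent_def intro!: exI[of _ "{x}"])

lemma connected_constituent: "connected (constituent S x)"
  unfolding constituent_def by (rule connected_Union) auto

lemma constituent_mono: "S \<subseteq> T \<Longrightarrow> constituent S x \<subseteq> constituent T x"
  by (auto simp: constituent_def)

lemma constituent_joined_finite:
  assumes "x \<in> S" "finite \<W>" "\<forall>W\<in>\<W>. constituent S x \<inter> W \<noteq> {}"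
  shows "\<exists>M. compact M \<and> connected M \<and> M \<subseteq> S \<and> x \<in> M \<and> (\<forall>W\<in>\<W>. M \<inter> W \<noteq> {})"
  using assms(2,3)
proof (induction \<W>)
  case empty
  then show ?case
    using assms(1) by (intro exI[of _ "{x}"]) simp
next
  case (insert W \<W>)
  then obtain M where M: "compact M" "connected M" "M \<subseteq> S" "x \<in> M" "\<forall>V\<in>\<W>. M \<inter> V \<noteq> {}"
    by auto
  obtain u where u: "u \<in> constituent S x" "u \<in> W"
    using insert.prems by blast
  from u(1) obtain M' where M': "compact M'" "connected M'" "M' \<subseteq> S" "x \<in> M'" "u \<in> M'"
    by (auto simp: constituent_def)
  have "connected (M \<union> M')"
    using M M' by (intro connected_Un) auto
  moreover have "(M \<union> M') \<inter> W \<noteq> {}"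
    using M'(5) u(2) by blast
  moreover have "\<forall>V\<in>\<W>. (M \<union> M') \<inter> V \<noteq> {}"
    using M(5) by blast
  ultimately show ?case
    using M M' by (intro exI[of _ "M \<union> M'"]) (simp add: compact_Un)
qed

text \<open>
  If the closure \<open>D\<close> of the constituent stays at distance \<open>d > 0\<close> from \<open>F\<close>, consider the component of \<open>x\<close>
  in the part of \<open>L\<close> at distance at least \<open>d/2\<close> from \<open>F\<close>. It is compact, so it belongs to the
  constituent and lies at distance at least \<open>d\<close> from \<open>F\<close>; by boundary bumping it also has a
  point at the frontier of that part, where the distance is \<open>d/2\<close>.
\<close>
lemma constituent_clusters_at_removed_set:
  fixes L F :: "'a::metric_space set"
  assumes L: "compact L" "connected L" and F: "compact F" "L \<inter> F \<noteq> {}" and x: "x \<in> L - F"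
  shows "closure (constituent (L - F) x) \<inter> F \<noteq> {}"
proof
  assume disj: "closure (constituent (L - F) x) \<inter> F = {}"
  let ?D = "closure (constituent (L - F) x)"
  have Fne: "F \<noteq> {}"
    using F(2) by auto
  have xD: "x \<in> ?D"
    using in_constituent[OF x] closure_subset by blast
  have "continuous_on F (\<lambda>z. infdist z ?D)"
    by (intro continuous_intros)
  then obtain z0 where z0: "z0 \<in> F" "\<And>z. z \<in> F \<Longrightarrow> infdist z0 ?D \<le> infdist z ?D"
    using continuous_attains_inf[OF F(1) Fne, of "\<lambda>z. infdist z ?D"] by blast
  define d where "d = infdist z0 ?D"
  have d: "d > 0"
    unfolding d_def using disj z0(1) xD by (intro infdist_pos_not_in_closed) auto
  have far': "d \<le> infdist y F" if "y \<in> constituent (L - F) x" for y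
  proof -
    have "d \<le> dist y z" if "z \<in> F" for z
      using z0(2)[OF that] infdist_le[of y ?D z] \<open>y \<in> constituent (L - F) x\<close>
        closure_subset[of "constituent (L - F) x"]
      by (auto simp: d_def dist_commute)
    then show ?thesis
      unfolding infdist_notempty[OF Fne] using Fne by (intro cINF_greatest) auto
  qed
  define N where "N = {y \<in> L. d/2 \<le> infdist y F}"
  have cloN: "closedin (top_of_set L) N"
  proof -
    have "closed {y. d/2 \<le> infdist y F}"
      by (intro closed_Collect_le continuous_intros)
    moreover have "N = L \<inter> {y. d/2 \<le> infdist y F}"
      by (auto simp: N_def)
    ultimately show ?thesis
      by (metis closedin_closed_Int)
  qed
  have xN: "x \<in> N"
    using far'[OF in_constituent[OF x]] d x by (auto simp: N_def)
  have NF: "N \<subseteq> L - F"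
    using d by (auto simp: N_def)
  define C where "C = connected_component_of_set (subtopology (top_of_set L) N) x"
  have NL: "N \<subseteq> L"
    by (auto simp: N_def)
  have C_eq: "subtopology (top_of_set L) N = top_of_set N"
    using NL by (simp add: subtopology_subtopology inf.absorb2)
  have compN: "compact N"
    using closedin_compact[OF L(1) cloN] .
  have "closedin (top_of_set N) C"
    unfolding C_def C_eq by (rule closedin_connected_component_of)
  then have "compact C"
    using compN closedin_compact by blast
  moreover have "connected C"
    using connectedin_connected_component_of[of "top_of_set N" x]
    unfolding C_def C_eq by (simp add: connectedin_subtopology)
  moreover have "C \<subseteq> N"
    unfolding C_def C_eq using connected_component_of_subset_topspace[of "top_of_set N" x] by simp
  moreover have "x \<in> C"
    unfolding C_def C_eq using xN by (simp add: connected_component_of_refl)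
  ultimately have C_const: "C \<subseteq> constituent (L - F) x"
    using NF by (auto simp: constituent_def)
  have "C \<inter> (top_of_set L) frontier_of N \<noteq> {}"
  proof (rule boundary_bumping_theorem_closed)
    show "connected_space (top_of_set L)"
      using L(2) by (simp add: connected_space_subtopology)
    show "compact_space (top_of_set L)"
      using L(1) by (simp add: compact_space_subtopology)
    show "Hausdorff_space (top_of_set L)"
      by (simp add: Hausdorff_space_subtopology)
    show "N \<noteq> topspace (top_of_set L)"
      using F(2) NF by auto
    show "C \<in> connected_components_of (subtopology (top_of_set L) N)"
      unfolding C_def C_eq using xN by (simp add: connected_component_in_connected_components_of)
  qed (rule cloN)
  then obtain y where y: "y \<in> C" "y \<in> (top_of_set L) frontier_of N"
    by blast
  have yL: "y \<in> L" using \<open>C \<subseteq> N\<close> NL y by auto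
  have "d/2 < infdist y F"
    using far'[of y] C_const y d by auto
  moreover have "openin (top_of_set L) {z \<in> L. d/2 < infdist z F}"
  proof -
    have "open {z. d/2 < infdist z F}"
      by (intro open_Collect_less continuous_intros)
    moreover have "{z \<in> L. d/2 < infdist z F} = L \<inter> {z. d/2 < infdist z F}"
      by auto
    ultimately show ?thesis
      by (metis openin_open_Int)
  qed
  moreover have "{z \<in> L. d/2 < infdist z F} \<subseteq> N"
    by (auto simp: N_def)
  ultimately have "y \<in> (top_of_set L) interior_of N"
    using yL by (auto simp: interior_of_def)
  then show False
    using y(2) by (simp add: frontier_of_def)
qed

section \<open>Closed connected subsets of an indecomposable semicontinuum\<close>

lemma connected_semicontinuum:
  assumes "semicontinuum X"
  shows "connected X"
proof -
  have "connected_component X x y" if "x \<in> X" "y \<in> X" for x y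
  proof (cases "x = y")
    case True
    then show ?thesis using that by simp
  next
    case False
    then obtain K where "continuum K" "K \<subseteq> X" "x \<in> K" "y \<in> K"
      using assms \<open>x \<in> X\<close> \<open>y \<in> X\<close> unfolding semicontinuum_def by blast
    then show ?thesis
      by (auto simp: connected_component_def continuum_def)
  qed
  then show ?thesis
    by (simp add: connected_iff_connected_component)
qed

text \<open>
  If \<open>A\<close> had interior points, \<open>X\<close> would decompose: as \<open>A\<close> and the closure of \<open>X - A\<close> when \<open>X - A\<close> is
  connected, and otherwise, for a separation of \<open>X - A\<close>, as the two sets obtained by
  adjoining either half to \<open>A\<close>. These are connected because \<open>X\<close> and \<open>A\<close> are.
\<close>
lemma indecomposable_closed_connected_interior_empty:
  fixes X A :: "'a::metric_space set"
  assumes X: "indecomposable_semicontinuum X"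
    and A: "closedin (top_of_set X) A" "connected A" "A \<noteq> X"
  shows "(top_of_set X) interior_of A = {}"
proof (rule ccontr)
  let ?T = "top_of_set X"
  assume int: "?T interior_of A \<noteq> {}"
  have conX: "connected X"
    using X connected_semicontinuum by (auto simp: indecomposable_semicontinuum_def)
  have AX: "A \<subseteq> X"
    using A(1) closedin_imp_subset by blast
  have no: False if "closedin ?T P" "connected P" "P \<noteq> X" "closedin ?T Q" "connected Q" "Q \<noteq> X" "X = P \<union> Q" for P Q
    using X that unfolding indecomposable_semicontinuum_def by blast
  show False
  proof (cases "connected (X - A)")
    case True
    have "?T closure_of (X - A) = X - ?T interior_of A"
      using closure_of_complement[of ?T A] by simp
    moreover have "connected (?T closure_of (X - A))"
    proof -
      have "connectedin ?T (X - A)"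
        using True by (simp add: connectedin_subtopology)
      then have "connectedin ?T (?T closure_of (X - A))"
        by (rule connectedin_closure_of)
      then show ?thesis
        by (simp add: connectedin_subtopology)
    qed
    moreover have "closedin ?T (?T closure_of (X - A))"
      by simp
    moreover have "X - ?T interior_of A \<noteq> X" "X = A \<union> (X - ?T interior_of A)"
      using int AX interior_of_subset_topspace[of ?T A] interior_of_subset[of ?T A] by auto
    ultimately show False
      using no[of A "X - ?T interior_of A"] A by metis
  next
    case False
    then obtain E where E: "openin (top_of_set (X - A)) E" "closedin (top_of_set (X - A)) E"
        "E \<noteq> {}" "E \<noteq> X - A"
      by (auto simp: connected_clopen)
    have EX: "E \<subseteq> X - A"
      using E(1) openin_imp_subset by blast
    have opeXA: "openin ?T (X - A)"
      using A(1) by (simp add: closedin_def)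
    have E': "openin (top_of_set (X - A)) (X - A - E)" "closedin (top_of_set (X - A)) (X - A - E)"
      using E(1,2) by (auto intro: openin_diff closedin_diff)
    have opeE: "openin ?T E" "openin ?T (X - A - E)"
      using openin_trans E(1) E'(1) opeXA by blast+
    have con: "connected (A \<union> E)" "connected (A \<union> (X - A - E))"
      using connected_Un_clopen_in_complement[OF A(2) conX AX] E E' by blast+
    have "A \<union> E = X - (X - A - E)" "A \<union> (X - A - E) = X - E"
      using AX EX by auto
    then have clo: "closedin ?T (A \<union> E)" "closedin ?T (A \<union> (X - A - E))"
      using opeE by (metis closedin_diff closedin_topspace topspace_euclidean_subtopology)+
    show False
      using no[of "A \<union> E" "A \<union> (X - A - E)"] con clo E(3,4) EX AX by blast
  qed
qed

lemma interior_of_finite_Union_empty: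
  assumes "finite \<A>" "\<And>A. A \<in> \<A> \<Longrightarrow> closedin T A \<and> T interior_of A = {}"
  shows "T interior_of (\<Union>\<A>) = {}"
  using assms by (induction \<A>) (simp_all add: interior_of_union_eq_empty)

section \<open>Continua avoiding a finite family\<close>

lemma connected_star_of_clustering_sets:
  assumes "connected K" "K \<noteq> {}" "\<And>C. C \<in> \<C> \<Longrightarrow> connected C \<and> closure C \<inter> K \<noteq> {}"
  shows "connected (K \<union> \<Union>\<C>)"
proof -
  have 1: "connected (K \<union> C)" if C: "C \<in> \<C>" for C
  proof -
    obtain z where z: "z \<in> closure C" "z \<in> K"
      using assms(3)[OF C] by blast
    have "connected (insert z C)"
      using connected_intermediate_closure[of C "insert z C"] assms(3)[OF C] z(1) closure_subset[of C] by auto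
    then have "connected (K \<union> insert z C)"
      using assms(1) z by (intro connected_Un) auto
    then show ?thesis
      using z by (simp add: insert_absorb)
  qed
  have "connected (\<Union>(insert K ((\<union>) K ` \<C>)))"
    using 1 assms(1,2) by (intro connected_Union) auto
  also have "\<Union>(insert K ((\<union>) K ` \<C>)) = K \<union> \<Union>\<C>"
    by auto
  finally show ?thesis .
qed

text \<open>
  Otherwise \<open>X\<close> would be covered by \<open>\<F>\<close> and finitely many closed connected sets \<open>A (W, K)\<close>, each
  missing part of \<open>W\<close> and hence nowhere dense. The family \<open>\<F>\<close> is non-empty because otherwise a
  compact \<open>X\<close> could itself be the continuum found; being disjoint from some \<open>K \<in> \<F>\<close> is what makes it a
  proper subset of \<open>X\<close>, which can join \<open>\<F>\<close> in the next step.
\<close>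
lemma continuum_avoiding_finite_family:
  fixes X :: "'a::metric_space set"
  assumes X: "indecomposable_semicontinuum X"
    and \<F>: "finite \<F>" "\<F> \<noteq> {}"
      "\<And>K. K \<in> \<F> \<Longrightarrow> compact K \<and> connected K \<and> K \<noteq> {} \<and> K \<subset> X"
    and \<W>: "finite \<W>" "\<And>W. W \<in> \<W> \<Longrightarrow> open W \<and> W \<inter> X \<noteq> {}"
  shows "\<exists>M. compact M \<and> connected M \<and> M \<noteq> {} \<and> M \<subseteq> X - \<Union>\<F> \<and> (\<forall>W\<in>\<W>. M \<inter> W \<noteq> {})"
proof (rule ccontr)
  let ?T = "top_of_set X" and ?F = "\<Union>\<F>"
  let ?C = "constituent (X - ?F)"
  assume none: "\<nexists>M. compact M \<and> connected M \<and> M \<noteq> {} \<and> M \<subseteq> X - ?F \<and> (\<forall>W\<in>\<W>. M \<inter> W \<noteq> {})"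
  have semi: "semicontinuum X"
    using X by (simp add: indecomposable_semicontinuum_def)
  have compF: "compact ?F"
    using \<F> by (intro compact_Union) auto
  have thin: "?T interior_of ?F = {}"
  proof (rule interior_of_finite_Union_empty[OF \<F>(1)])
    fix K assume "K \<in> \<F>"
    then have "compact K" "connected K" "K \<subset> X"
      using \<F>(3) by auto
    then show "closedin ?T K \<and> ?T interior_of K = {}"
      using indecomposable_closed_connected_interior_empty[OF X, of K] closed_subset[of K X]
      by (auto simp: compact_imp_closed)
  qed
  have miss: "\<exists>W\<in>\<W>. ?C x \<inter> W = {}" if "x \<in> X - ?F" for x
    using constituent_joined_finite[OF that \<W>(1)] none by blast
  have cluster: "\<exists>K\<in>\<F>. closure (?C x) \<inter> K \<noteq> {}" if x: "x \<in> X - ?F" for x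
  proof -
    obtain K p where K: "K \<in> \<F>" "p \<in> K" "p \<in> X" "p \<noteq> x"
      using \<F>(2,3) x by blast
    obtain L where L: "continuum L" "L \<subseteq> X" "x \<in> L" "p \<in> L"
      using semi K(3,4) x unfolding semicontinuum_def by (metis DiffD1)
    \<comment> \<open>Boundary bumping needs compactness, so it is applied in \<open>L\<close> rather than in \<open>X\<close>.\<close>
    have "closure (constituent (L - ?F) x) \<inter> ?F \<noteq> {}"
      using L K x compF by (intro constituent_clusters_at_removed_set) (auto simp: continuum_def)
    moreover have "closure (constituent (L - ?F) x) \<subseteq> closure (?C x)"
      using L(2) by (intro closure_mono constituent_mono) auto
    ultimately show ?thesis
      by blast
  qed
  define B where "B = (\<lambda>(W, K). K \<union> \<Union>{?C x |x. x \<in> X - ?F \<and> ?C x \<inter> W = {} \<and> closure (?C x) \<inter> K \<noteq> {}})"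
  define A where "A = (\<lambda>i. ?T closure_of B i)"
  have A: "closedin ?T (A i) \<and> ?T interior_of (A i) = {}" if i: "i \<in> \<W> \<times> \<F>" for i
  proof -
    obtain W K where i_eq: "i = (W, K)" and W: "W \<in> \<W>" and K: "K \<in> \<F>"
      using i by auto
    have "connected (B i)"
      unfolding B_def i_eq prod.case using \<F>(3)[OF K]
      by (intro connected_star_of_clustering_sets) (auto simp: connected_constituent)
    moreover have BX: "B i \<subseteq> X"
      using \<F>(3)[OF K] constituent_subset[of "X - ?F"] by (auto simp: B_def i_eq)
    ultimately have "connected (A i)"
      using connectedin_closure_of[of ?T "B i"] by (simp add: A_def connectedin_subtopology)
    moreover have "A i \<noteq> X"
    proof -
      \<comment> \<open>\<open>K\<close> may itself meet \<open>W\<close>, so the part of \<open>W\<close> outside \<open>?F\<close> is the open set that is missed;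
        it meets \<open>X\<close> because \<open>?F\<close> has empty interior.\<close>
      have "openin ?T (X \<inter> W)" "X \<inter> W \<noteq> {}"
        using \<W>(2)[OF W] by (auto simp: openin_open_Int)
      then have "\<not> X \<inter> W \<subseteq> ?F"
        using thin interior_of_maximal[of "X \<inter> W" ?F ?T] by auto
      then obtain u where u: "u \<in> X" "u \<in> W - ?F"
        by auto
      have "open (W - ?F)"
        using \<W>(2)[OF W] compF by (simp add: compact_imp_closed open_Diff)
      moreover have "B i \<inter> (W - ?F) = {}"
        using K by (auto simp: B_def i_eq)
      ultimately have "u \<notin> closure (B i)"
        using u open_Int_closure_eq_empty[of "W - ?F" "B i"] by blast
      moreover have "A i \<subseteq> closure (B i)"
        using BX by (simp add: A_def closure_of_subtopology inf.absorb2)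
      ultimately show ?thesis
        using u by auto
    qed
    moreover have "closedin ?T (A i)"
      by (simp add: A_def)
    ultimately show ?thesis
      using indecomposable_closed_connected_interior_empty[OF X] by blast
  qed
  have "X - ?F \<subseteq> \<Union>(A ` (\<W> \<times> \<F>))"
  proof
    fix x assume x: "x \<in> X - ?F"
    obtain W K where "W \<in> \<W>" "K \<in> \<F>" "?C x \<inter> W = {}" "closure (?C x) \<inter> K \<noteq> {}"
      using miss[OF x] cluster[OF x] by blast
    moreover from this have "x \<in> B (W, K)"
      using in_constituent[OF x] x unfolding B_def prod.case by blast
    then have "x \<in> A (W, K)"
      using x closure_of_subset_Int[of ?T "B (W, K)"] by (auto simp: A_def)
    ultimately show "x \<in> \<Union>(A ` (\<W> \<times> \<F>))"
      by blast
  qed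
  moreover have "?F \<subseteq> X"
    using \<F>(3) by blast
  moreover have "A i \<subseteq> X" if "i \<in> \<W> \<times> \<F>" for i
    using closure_of_subset_topspace[of ?T "B i"] by (simp add: A_def)
  ultimately have X_eq: "?F \<union> \<Union>(A ` (\<W> \<times> \<F>)) = X"
    by blast
  have "?T interior_of (\<Union>(A ` (\<W> \<times> \<F>))) = {}"
    using A \<W>(1) \<F>(1) by (intro interior_of_finite_Union_empty) auto
  moreover have "closedin ?T ?F"
    using \<open>?F \<subseteq> X\<close> compF by (simp add: closed_subset compact_imp_closed)
  ultimately have "?T interior_of X = {}"
    using thin interior_of_union_eq_empty X_eq by metis
  moreover have "?T interior_of X = X"
    using interior_of_topspace[of ?T] by simp
  ultimately show False
    using \<F>(2,3) by blast
qed

lemma dense_continuum_avoiding_finite_family: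
  fixes X Y :: "'a::metric_space set"
  assumes X: "indecomposable_semicontinuum X"
    and Y: "continuum Y" "Y \<subseteq> closure X" "X \<subseteq> Y"
    and \<F>: "finite \<F>" "\<F> \<noteq> {}"
      "\<And>K. K \<in> \<F> \<Longrightarrow> compact K \<and> connected K \<and> K \<noteq> {} \<and> K \<subset> X"
    and e: "e > 0"
  shows "\<exists>M. continuum M \<and> M \<subseteq> X - \<Union>\<F> \<and> (\<forall>y\<in>Y. infdist y M \<le> e)"
proof -
  obtain a b where ab: "a \<in> Y" "b \<in> Y" "a \<noteq> b"
    using Y(1) by (auto simp: continuum_def)
  \<comment> \<open>The second bound keeps the continuum from shrinking to a point: it has points within \<open>2 * r\<close>
    of \<open>a\<close> and of \<open>b\<close>, which are then distinct.\<close>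
  define r where "r = min (e/2) (dist a b / 4)"
  have r: "r > 0" "2*r \<le> e" "4*r \<le> dist a b"
    using e ab by (auto simp: r_def)
  have "Y \<subseteq> (\<Union>x\<in>X. ball x r)"
  proof
    fix y assume "y \<in> Y"
    then obtain x where "x \<in> X" "dist x y < r"
      using Y(2) r(1) closure_approachable by blast
    then show "y \<in> (\<Union>x\<in>X. ball x r)"
      by auto
  qed
  then obtain N where N: "N \<subseteq> X" "finite N" "Y \<subseteq> (\<Union>x\<in>N. ball x r)"
    using Y(1) compactE_image[of Y X "\<lambda>x. ball x r"] by (auto simp: continuum_def)
  have "\<exists>M. compact M \<and> connected M \<and> M \<noteq> {} \<and> M \<subseteq> X - \<Union>\<F> \<and> (\<forall>W\<in>(\<lambda>x. ball x r) ` N. M \<inter> W \<noteq> {})"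
  proof (rule continuum_avoiding_finite_family[OF X \<F>])
    fix W assume "W \<in> (\<lambda>x. ball x r) ` N"
    then show "open W \<and> W \<inter> X \<noteq> {}"
      using N(1) r(1) centre_in_ball by blast
  qed (use N in auto)
  then obtain M where M: "compact M" "connected M" "M \<noteq> {}" "M \<subseteq> X - \<Union>\<F>"
      and meet: "\<forall>W\<in>(\<lambda>x. ball x r) ` N. M \<inter> W \<noteq> {}"
    by metis
  have near: "\<exists>m\<in>M. dist y m < 2*r" if "y \<in> Y" for y
  proof -
    have "y \<in> (\<Union>x\<in>N. ball x r)"
      using N(3) that by (rule subsetD)
    then obtain x where x: "x \<in> N" "dist x y < r"
      by auto
    then obtain m where "m \<in> M" "dist x m < r"
      using meet by fastforce
    then show ?thesis
      using x dist_triangle[of y m x] by (intro bexI[of _ m]) (auto simp: dist_commute)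
  qed
  have "\<exists>x\<in>M. \<exists>y\<in>M. x \<noteq> y"
  proof -
    obtain m n where mn: "m \<in> M" "dist a m < 2*r" "n \<in> M" "dist b n < 2*r"
      using near ab by blast
    have "m \<noteq> n"
      using mn dist_triangle2[of a b m] r(3) by auto
    then show ?thesis
      using mn by blast
  qed
  then have "continuum M"
    using M by (auto simp: continuum_def)
  moreover have "infdist y M \<le> e" if "y \<in> Y" for y
  proof -
    obtain m where "m \<in> M" "dist y m < 2*r"
      using near[OF \<open>y \<in> Y\<close>] by blast
    then show ?thesis
      using infdist_le[of m M y] r(2) by linarith
  qed
  ultimately show ?thesis
    using M(4) by blast
qed

section \<open>The sequence\<close>

theorem mainTheorem4:
  fixes X Y :: "'a::metric_space set"
  assumes "continuum Y"
    and "X \<subseteq> Y"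
    and "Y \<subseteq> closure X"
    and "indecomposable_semicontinuum X"
  shows "\<exists>K :: nat \<Rightarrow> 'a set.
           (\<forall>n. continuum (K n) \<and> K n \<subseteq> Y) \<and>
           disjoint_family K \<and>
           (\<lambda>n. SUP y\<in>Y. infdist y (K n)) \<longlonglongrightarrow> 0"
proof -
  obtain a b where ab: "a \<in> Y" "b \<in> Y" "a \<noteq> b"
    using assms(1) by (auto simp: continuum_def)
  obtain p where p: "p \<in> X"
    using ab assms(3) by fastforce
  have "X \<noteq> {p}"
    using ab assms(3) closure_closed[OF closed_singleton, of p] by fastforce
  then have sing: "{p} \<subset> X"
    using p by auto
  \<comment> \<open>All continua avoid a fixed point \<open>p\<close>. This makes each of them a proper subset of \<open>X\<close> and gives the
    first step a non-empty family.\<close>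
  define P :: "(nat \<Rightarrow> 'a set) \<Rightarrow> nat \<Rightarrow> 'a set \<Rightarrow> bool" where
    "P = (\<lambda>f n M. continuum M \<and> M \<subseteq> X \<and> p \<notin> M \<and> (\<forall>m<n. M \<inter> f m = {}) \<and>
                  (\<forall>y\<in>Y. infdist y M \<le> 1 / real (Suc n)))"
  have "\<exists>K. \<forall>n. P K n (K n)"
  proof (rule dependent_wellorder_choice)
    fix n f assume prev: "\<And>m. m < n \<Longrightarrow> P f m (f m)"
    let ?\<F> = "insert {p} (f ` {..<n})"
    have "\<exists>M. continuum M \<and> M \<subseteq> X - \<Union>?\<F> \<and> (\<forall>y\<in>Y. infdist y M \<le> 1 / real (Suc n))"
    proof (rule dense_continuum_avoiding_finite_family[OF assms(4,1,3,2)])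
      fix K assume "K \<in> ?\<F>"
      then show "compact K \<and> connected K \<and> K \<noteq> {} \<and> K \<subset> X"
        using sing prev p by (fastforce simp: P_def continuum_def)
    qed auto
    then show "\<exists>M. P f n M"
      unfolding P_def by (fastforce)
  qed (auto simp: P_def)
  then obtain K where K: "\<And>n. P K n (K n)"
    by blast
  have "disjoint_family K"
    unfolding disjoint_family_on_def
  proof (intro ballI impI)
    fix m n :: nat assume "m \<noteq> n"
    then show "K m \<inter> K n = {}"
      using K[of m] K[of n] unfolding P_def by (metis Int_commute linorder_neqE_nat)
  qed
  moreover have "(\<lambda>n. SUP y\<in>Y. infdist y (K n)) \<longlonglongrightarrow> 0"
  proof (rule tendsto_sandwich[OF _ _ tendsto_const LIMSEQ_inverse_real_of_nat])
    have le: "infdist y (K n) \<le> inverse (real (Suc n))" if "y \<in> Y" for y n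
      using K[of n] that by (auto simp: P_def inverse_eq_divide)
    show "\<forall>\<^sub>F n in sequentially. (SUP y\<in>Y. infdist y (K n)) \<le> inverse (real (Suc n))"
      using le ab by (intro always_eventually allI cSUP_least) auto
    show "\<forall>\<^sub>F n in sequentially. 0 \<le> (SUP y\<in>Y. infdist y (K n))"
      using le ab by (intro always_eventually allI cSUP_upper2[of _ _ a]) (auto simp: infdist_nonneg intro!: bdd_aboveI2)
  qed
  ultimately show ?thesis
    using K assms(2) unfolding P_def by blast
qed

end
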